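(* Let $(u_0,v_0)$ be a standard pair and let $F_1,F_2$ be two cumulative distribution functions on $\mathbb{R}$ such that $\int_{-\infty}^{\infty}|u_0(x)|\,dv_0(F(x))<\infty$ for $F=F_1$ and $F=F_2$. Then the following are equivalent: (i) $\int_{-\infty}^{c}v_0(F_1(x))\,du_0(x)\ \ge\ \int_{-\infty}^{c}v_0(F_2(x))\,du_0(x)$ for all $c\in\mathbb{R}$; (ii) $\int_0^pu_0(F_1^{-1}(\alpha))\,dv_0(\alpha)\ \le\ \int_0^pu_0(F_2^{-1}(\alpha))\,dv_0(\alpha)$ for all $p\in[0,1)$.
   Context: "Increasing" means non-decreasing. Cdf's $F$ are right continuous, and $F^{-1}(\alpha)=\inf\{x:F(x)\ge\alpha\}$ for $\alpha\in(0,1)$, which is left continuous. Standard pair: $(u_0,v_0)$ is a standard pair if $u_0:\mathbb{R}\to\mathbb{R}$ is increasing and left continuous, and $v_0:[0,1]\to[0,1]$ is increasing and right continuous with $v_0(0)=0$ and $v_0(1^-)=1$. Integrals: all integrals are Lebesgue–Stieltjes integrals. For a right continuous integrator (e.g. $v_0$, $v_0\circ F$) integrals extend over intervals $(a,b]$, and the measure of $(a,b]$ is the increment of the integrator; thus $\int_0^p\cdots dv_0$ is over $(0,p]$. For a left continuous integrator (e.g. $u_0$) integrals extend over intervals $[a,b)$, and the measure of $[a,b)$ is the increment of the integrator; thus $\int_{-\infty}^c\cdots du_0$ is over $(-\infty,c)$. *)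

theory Defs
  imports "HOL-Probability.Probability"
begin

definition is_cdf :: "(real \<Rightarrow> real) \<Rightarrow> bool" where
  "is_cdf F \<longleftrightarrow> (\<exists>M. real_distribution M \<and> F = cdf M)"

definition quantile :: "(real \<Rightarrow> real) \<Rightarrow> real \<Rightarrow> real" where
  "quantile F \<alpha> = Inf {x. F x \<ge> \<alpha>}"

text \<open>The second component is only meaningful on \<open>{0..1}\<close>; its values elsewhere are ignored.\<close>

definition standard_pair :: "(real \<Rightarrow> real) \<Rightarrow> (real \<Rightarrow> real) \<Rightarrow> bool" where
  "standard_pair u v \<longleftrightarrow>
     mono u \<and> (\<forall>x. continuous (at_left x) u) \<and>
     v \<in> {0..1} \<rightarrow> {0..1} \<and> mono_on {0..1} v \<and>
     (\<forall>x\<in>{0..<1}. continuous (at_right x) v) \<and>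
     v 0 = 0 \<and> (v \<longlongrightarrow> 1) (at_left 1)"

text \<open>
  The Lebesgue--Stieltjes measure of a left continuous increasing integrator, giving \<open>{a..<b}\<close>
  mass \<open>u b - u a\<close>. As \<^const>\<open>interval_measure\<close> expects a right continuous integrator, it is
  obtained by reflecting the line.
\<close>

definition left_interval_measure :: "(real \<Rightarrow> real) \<Rightarrow> real measure" where
  "left_interval_measure u = distr (interval_measure (\<lambda>y. - u (- y))) borel uminus"

text \<open>
  The Lebesgue--Stieltjes measure of a right continuous increasing integrator on \<open>{0..1}\<close>, which
  is extended to the line by constants so that no mass lies outside \<open>{0<..1}\<close>.
\<close>

definition unit_interval_measure :: "(real \<Rightarrow> real) \<Rightarrow> real measure" where
  "unit_interval_measure v = interval_measure (\<lambda>\<alpha>. v (max 0 (min 1 \<alpha>)))"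

lemma emeasure_left_interval_measure:
  assumes "mono u" and "\<And>x. continuous (at_left x) u" and "a \<le> b"
  shows "emeasure (left_interval_measure u) {a..<b} = ennreal (u b - u a)"
proof -
  have right: "continuous (at_right y) (\<lambda>y. - u (- y))" for y :: real
  proof -
    have "(u \<longlongrightarrow> u (- y)) (at_left (- y))"
      using assms(2)[of "- y"] by (simp add: continuous_within)
    then have "((\<lambda>y. u (- y)) \<longlongrightarrow> u (- y)) (at_right y)"
      by (simp add: filterlim_at_left_to_right[of _ _ "- y"])
    then show ?thesis
      by (simp add: continuous_within tendsto_minus)
  qed
  have vim: "uminus -` {a..<b} = {- b<..- a}"
    by auto
  have "emeasure (left_interval_measure u) {a..<b}
      = emeasure (interval_measure (\<lambda>y. - u (- y))) {- b<..- a}"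
    by (simp add: left_interval_measure_def emeasure_distr vim)
  also have "\<dots> = ennreal (u b - u a)"
    using assms(1,3) right by (subst emeasure_interval_measure_Ioc) (auto simp: mono_def)
  finally show ?thesis .
qed

lemma emeasure_unit_interval_measure:
  assumes "standard_pair u v" and "0 \<le> a" "a \<le> b" "b \<le> 1"
  shows "emeasure (unit_interval_measure v) {a<..b} = ennreal (v b - v a)"
proof -
  let ?w = "\<lambda>\<alpha>::real. v (max 0 (min 1 \<alpha>))"
  have mono: "?w x \<le> ?w y" if "x \<le> y" for x y
    using assms(1) that by (auto simp: standard_pair_def intro!: mono_onD[of "{0..1}" v])
  have right: "continuous (at_right x) ?w" for x
  proof -
    consider "x < 0" | "0 \<le> x" "x < 1" | "1 \<le> x" by linarith
    then show ?thesis
    proof cases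
      case 1
      have "eventually (\<lambda>y. ?w y = v 0) (at_right x)"
        using 1 by (intro eventually_at_rightI[of x 0]) auto
      then show ?thesis
        using 1 by (simp add: continuous_within tendsto_eventually)
    next
      case 2
      have "(v \<longlongrightarrow> v x) (at_right x)"
        using assms(1) 2 by (simp add: standard_pair_def continuous_within)
      moreover have "eventually (\<lambda>y. v y = ?w y) (at_right x)"
        using 2 by (intro eventually_at_rightI[of x 1]) auto
      ultimately show ?thesis
        using 2 by (auto simp: continuous_within elim: Lim_transform_eventually)
    next
      case 3
      have "eventually (\<lambda>y. ?w y = v 1) (at_right x)"
        using 3 by (intro eventually_at_rightI[of x "x + 1"]) auto
      then show ?thesis
        using 3 by (simp add: continuous_within tendsto_eventually)
    qed
  qed
  show ?thesis
    unfolding unit_interval_measure_def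
    using assms mono right by (subst emeasure_interval_measure_Ioc) auto
qed

end

theory Submission
  imports Defs
begin

text \<open>
  Let \<open>\<mu>\<close> be the probability measure \<open>dv\<close> on the open unit interval. The quantile transform pushes
  \<open>\<mu>\<close> to \<open>d(v \<circ> F)\<close>, so Tonelli turns the integral in (i) into the hinge expectation
  \<open>\<integral> (u c - u (F\<inverse> \<alpha>))\<^sup>+ d\<mu>\<close>. Such an expectation dominates \<open>\<integral>\<^sub>S (u c - u (F\<inverse> \<alpha>)) d\<mu>\<close> for every
  set \<open>S\<close>, with equality when \<open>S\<close> is an initial segment \<open>{0<..p}\<close> on which \<open>F\<inverse> \<le> c\<close> and outside
  of which \<open>F\<inverse> \<ge> c\<close>. For (ii) \<open>\<Longrightarrow>\<close> (i) take \<open>p = F2 c\<close>, which makes the second hinge expectation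
  an equality; for (i) \<open>\<Longrightarrow>\<close> (ii) take \<open>c = F1\<inverse> p\<close>, which makes the first one an equality.
\<close>

text \<open>Monotonicity sends points to the right of x into \<open>{f x..}\<close>, and adding the
  limit point itself to a punctured neighbourhood does not change the filter.\<close>

lemma continuous_at_right_compose_mono:
  fixes f :: "real \<Rightarrow> real" and g :: "real \<Rightarrow> 'a::topological_space"
  assumes "mono f" "continuous (at_right x) f" "continuous (at_right (f x)) g"
  shows "continuous (at_right x) (\<lambda>y. g (f y))"
proof (rule continuous_within_compose2)
  have "at (f x) within {f x..} = at_right (f x)"
    by (auto simp: at_within_def intro!: arg_cong[where f = "\<lambda>S. inf (nhds (f x)) (principal S)"])
  then have "continuous (at (f x) within {f x..}) g"
    using assms(3) by simp
  then show "continuous (at (f x) within f ` {x<..}) g"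
    by (rule continuous_within_subset) (use assms(1) in \<open>auto simp: mono_def\<close>)
qed (fact assms(2))

section \<open>Distribution functions and quantiles\<close>

lemma
  assumes "is_cdf F"
  shows is_cdf_mono: "mono F"
    and is_cdf_right_cont: "continuous (at_right x) F"
    and is_cdf_at_bot: "(F \<longlongrightarrow> 0) at_bot"
    and is_cdf_at_top: "(F \<longlongrightarrow> 1) at_top"
    and is_cdf_nonneg: "0 \<le> F x"
    and is_cdf_le_1: "F x \<le> 1"
proof -
  obtain M where M: "real_distribution M" and F: "F = cdf M"
    using assms unfolding is_cdf_def by auto
  interpret real_distribution M by fact
  show "mono F" "continuous (at_right x) F" "(F \<longlongrightarrow> 0) at_bot" "(F \<longlongrightarrow> 1) at_top"
    "0 \<le> F x" "F x \<le> 1"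
    unfolding F mono_def
    by (auto simp: cdf_nondecreasing cdf_is_right_cont cdf_lim_at_bot cdf_lim_at_top_prob
        cdf_nonneg cdf_bounded_prob)
qed

text \<open>The limits of F at both ends make the set behind the infimum nonempty and bounded below,
  monotonicity makes it upward closed, and right continuity makes the infimum attained.\<close>

lemma quantile_le_iff:
  assumes F: "is_cdf F" and \<alpha>: "0 < \<alpha>" "\<alpha> < 1"
  shows "quantile F \<alpha> \<le> x \<longleftrightarrow> \<alpha> \<le> F x"
proof
  let ?S = "{x. \<alpha> \<le> F x}"
  obtain b where b: "\<And>y. y \<le> b \<Longrightarrow> F y < \<alpha>"
    using order_tendstoD(2)[OF is_cdf_at_bot[OF F] \<alpha>(1)] by (auto simp: eventually_at_bot_linorder)
  have bdd: "bdd_below ?S"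
    using b by (intro bdd_belowI[of _ b]) (metis linorder_not_le mem_Collect_eq nle_le)
  obtain a where "\<alpha> < F a"
    using order_tendstoD(1)[OF is_cdf_at_top[OF F] \<alpha>(2)] by (auto simp: eventually_at_top_linorder)
  then have ne: "?S \<noteq> {}" by (auto intro: less_imp_le)
  show "quantile F \<alpha> \<le> x" if "\<alpha> \<le> F x"
    unfolding quantile_def using that bdd by (intro cInf_lower) auto
  have above: "\<alpha> \<le> F y" if "quantile F \<alpha> < y" for y
  proof -
    have "\<exists>z\<in>?S. z < y"
      using that unfolding quantile_def by (rule cInf_less_iff[OF ne bdd, THEN iffD1])
    then obtain z where "z \<in> ?S" "z < y" ..
    then show ?thesis using monoD[OF is_cdf_mono[OF F], of z y] by auto
  qed
  have "\<alpha> \<le> F (quantile F \<alpha>)"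
  proof (rule tendsto_lowerbound)
    show "(F \<longlongrightarrow> F (quantile F \<alpha>)) (at_right (quantile F \<alpha>))"
      using is_cdf_right_cont[OF F] by (simp add: continuous_within)
    show "\<forall>\<^sub>F y in at_right (quantile F \<alpha>). \<alpha> \<le> F y"
      using above by (auto simp: eventually_at_filter)
  qed simp
  then show "\<alpha> \<le> F x" if "quantile F \<alpha> \<le> x"
    using monoD[OF is_cdf_mono[OF F] that] by auto
qed

lemma quantile_mono:
  assumes F: "is_cdf F" and "0 < \<alpha>" "\<alpha> \<le> \<beta>" "\<beta> < 1"
  shows "quantile F \<alpha> \<le> quantile F \<beta>"
proof -
  have "\<beta> \<le> F (quantile F \<beta>)"
    using assms by (subst quantile_le_iff[symmetric]) auto
  then show ?thesis
    using assms by (subst quantile_le_iff) auto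
qed

text \<open>
  Outside the open unit interval \<^const>\<open>quantile\<close> is an infimum of an empty or unbounded set;
  the junk values are replaced by \<open>0\<close> to obtain a measurable function.
\<close>

definition quantile0 :: "(real \<Rightarrow> real) \<Rightarrow> real \<Rightarrow> real" where
  "quantile0 F \<alpha> = (if 0 < \<alpha> \<and> \<alpha> < 1 then quantile F \<alpha> else 0)"

lemma measurable_quantile0 [measurable]:
  assumes F: "is_cdf F"
  shows "quantile0 F \<in> borel_measurable borel"
proof (rule borel_measurableI_le)
  fix x
  \<comment> \<open>The complement of the open unit interval enters because of the default value 0
    there.\<close>
  have "{\<alpha> \<in> space borel. quantile0 F \<alpha> \<le> x}
      = ({0<..<1} \<inter> {..F x}) \<union> (if 0 \<le> x then - {0<..<1} else {})"
    using quantile_le_iff[OF F] by (auto simp: quantile0_def split: if_splits)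
  also have "\<dots> \<in> sets borel" by auto
  finally show "{\<alpha> \<in> space borel. quantile0 F \<alpha> \<le> x} \<in> sets borel" .
qed

section \<open>The measures of a standard pair\<close>

lemma sets_unit_interval_measure [simp, measurable_cong]: "sets (unit_interval_measure v) = sets borel"
  by (simp add: unit_interval_measure_def)

lemma sets_left_interval_measure [simp, measurable_cong]: "sets (left_interval_measure u) = sets borel"
  by (simp add: left_interval_measure_def)

lemma space_left_interval_measure [simp]: "space (left_interval_measure u) = UNIV"
  by (simp add: left_interval_measure_def)

text \<open>Required for exchanging the two integrals in
  \<open>nn_integral_eq_hinge\<close>.\<close>

lemma sigma_finite_left_interval_measure:
  assumes "mono u" "\<And>x. continuous (at_left x) u"
  shows "sigma_finite_measure (left_interval_measure u)"
proof
  show "\<exists>A. countable A \<and> A \<subseteq> sets (left_interval_measure u) \<and>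
      \<Union> A = space (left_interval_measure u) \<and>
      (\<forall>a\<in>A. emeasure (left_interval_measure u) a \<noteq> \<infinity>)"
  proof (intro exI conjI ballI)
    let ?A = "range (\<lambda>n. {- real n..<real n})"
    show "countable ?A" "?A \<subseteq> sets (left_interval_measure u)" by auto
    have "\<exists>n. - real n \<le> x \<and> x < real n" for x
    proof -
      obtain n where "\<bar>x\<bar> < real n" using reals_Archimedean2 by blast
      then show ?thesis by (intro exI[of _ n]) linarith
    qed
    then show "\<Union> ?A = space (left_interval_measure u)" by auto
    show "emeasure (left_interval_measure u) a \<noteq> \<infinity>" if "a \<in> ?A" for a
      using that emeasure_left_interval_measure[OF assms] by auto
  qed
qed

section \<open>Quantile transform and hinge representation for a single distribution
  function\<close>

locale standard_pair_cdf =
  fixes u v F :: "real \<Rightarrow> real"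
  assumes sp: "standard_pair u v" and F: "is_cdf F"
begin

abbreviation \<mu> :: "real measure" where "\<mu> \<equiv> unit_interval_measure v"

lemma u_mono: "x \<le> y \<Longrightarrow> u x \<le> u y"
  using sp by (auto simp: standard_pair_def mono_def)

lemma measurable_u [measurable]: "u \<in> borel_measurable borel"
  using sp by (intro borel_measurable_mono) (simp add: standard_pair_def)

lemma v_1: "v 1 = 1"
proof (rule antisym)
  show "v 1 \<le> 1" using sp by (auto simp: standard_pair_def)
  show "1 \<le> v 1"
  proof (rule tendsto_upperbound)
    show "(v \<longlongrightarrow> 1) (at_left 1)" using sp by (simp add: standard_pair_def)
    show "\<forall>\<^sub>F x in at_left 1. v x \<le> v 1"
      using sp by (intro eventually_at_leftI[of 0]) (auto simp: standard_pair_def intro!: mono_onD[of _ v])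
  qed simp
qed

text \<open>The distribution function of \<mu>, as \<open>cdf_\<mu>\<close> confirms.\<close>

definition w :: "real \<Rightarrow> real" where "w \<alpha> = v (max 0 (min 1 \<alpha>))"

lemma \<mu>_eq: "\<mu> = interval_measure w"
  by (simp add: unit_interval_measure_def w_def[abs_def])

lemma w_mono: "x \<le> y \<Longrightarrow> w x \<le> w y"
  using sp by (auto simp: w_def standard_pair_def intro!: mono_onD[of "{0..1}" v])

lemma w_right_cont: "continuous (at_right x) w"
\<comment> \<open>For x < 1 the clamped point lies in [0,1), where v is assumed right continuous;
  from 1 onwards w is constant.\<close>
proof (cases "x < 1")
  case True
  show ?thesis
    unfolding w_def
  proof (rule continuous_at_right_compose_mono[where g = v])
    show "mono (\<lambda>\<alpha>::real. max 0 (min 1 \<alpha>))" by (auto simp: mono_def)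
    show "continuous (at_right x) (\<lambda>\<alpha>::real. max 0 (min 1 \<alpha>))" by (intro continuous_intros)
    show "continuous (at_right (max 0 (min 1 x))) v"
      using sp True by (auto simp: standard_pair_def)
  qed
next
  case False
  then have "\<forall>\<^sub>F y in at_right x. w y = w x"
    by (intro eventually_at_rightI[of x "x + 1"]) (auto simp: w_def)
  then show ?thesis by (simp add: continuous_within tendsto_eventually)
qed

lemma w_0: "w x = 0" if "x \<le> 0"
  using that sp by (simp add: w_def standard_pair_def)

lemma w_1: "w x = 1" if "1 \<le> x"
  using that v_1 by (simp add: w_def)

lemma w_at_bot: "(w \<longlongrightarrow> 0) at_bot"
  by (rule tendsto_eventually) (auto simp: eventually_at_bot_linorder intro!: exI[of _ 0] w_0)

lemma real_distribution_\<mu>: "real_distribution \<mu>"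
  unfolding \<mu>_eq
proof (rule real_distribution_interval_measure)
  show "(w \<longlongrightarrow> 1) at_top"
    by (rule tendsto_eventually) (auto simp: eventually_at_top_linorder intro!: exI[of _ 1] w_1)
qed (auto simp: w_mono w_right_cont w_at_bot)

sublocale \<mu>: real_distribution \<mu> by (rule real_distribution_\<mu>)

lemma cdf_\<mu>: "cdf \<mu> = w"
  unfolding \<mu>_eq by (rule cdf_interval_measure) (auto simp: w_mono w_right_cont w_at_bot)

text \<open>The mass of \<open>{..<1}\<close> is the left limit of w at 1, which the condition v(1-)
  = 1 makes full; the mass of \<open>{..0}\<close> is w 0 = 0. Hence values of the quantile outside
  (0,1) never matter under \<mu>.\<close>

lemma AE_\<mu>: "AE \<alpha> in \<mu>. 0 < \<alpha> \<and> \<alpha> < 1"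
proof -
  have "(w \<longlongrightarrow> 1) (at_left 1)"
  proof (rule Lim_transform_eventually)
    show "(v \<longlongrightarrow> 1) (at_left 1)" using sp by (simp add: standard_pair_def)
    show "\<forall>\<^sub>F x in at_left 1. v x = w x"
      by (rule eventually_at_leftI[of 0]) (auto simp: w_def)
  qed
  then have "measure \<mu> {..<1} = 1"
    using tendsto_unique[OF _ \<mu>.cdf_at_left[of 1]] cdf_\<mu> by auto
  then have "AE \<alpha> in \<mu>. \<alpha> \<in> {..<1}"
    by (subst \<mu>.AE_in_set_eq_1) auto
  moreover have "measure \<mu> {..0} = 0"
    using w_0[of 0] by (simp flip: cdf_\<mu> cdf_def2)
  then have "AE \<alpha> in \<mu>. \<alpha> \<notin> {..0}"
    by (intro AE_not_in) (auto simp: null_sets_def \<mu>.emeasure_eq_measure)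
  ultimately show ?thesis by eventually_elim auto
qed

lemma v_F: "v (F x) = w (F x)"
  using is_cdf_nonneg[OF F] is_cdf_le_1[OF F] by (simp add: w_def)

lemma emeasure_\<mu>_F: "emeasure \<mu> {0<..F x} = ennreal (v (F x))"
  using emeasure_unit_interval_measure[OF sp, of 0 "F x"] sp is_cdf_nonneg[OF F] is_cdf_le_1[OF F]
  by (simp add: standard_pair_def)

lemma quantile0_le_iff: "0 < \<alpha> \<and> \<alpha> < 1 \<Longrightarrow> quantile0 F \<alpha> \<le> x \<longleftrightarrow> \<alpha> \<le> F x"
  using quantile_le_iff[OF F] by (simp add: quantile0_def)

lemma quantile0_mono: "0 < \<alpha> \<Longrightarrow> \<alpha> \<le> \<beta> \<Longrightarrow> \<beta> < 1 \<Longrightarrow> quantile0 F \<alpha> \<le> quantile0 F \<beta>"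
  using quantile_mono[OF F] by (simp add: quantile0_def)

lemmas measurable_quantile0_F [measurable] = measurable_quantile0[OF F]

text \<open>Inverse transform sampling: by \<open>quantile0_le_iff\<close>, the event that the
  quantile is at most x is almost surely \<open>{..F x}\<close>, so both measures have distribution
  function v \<circ> F.\<close>

lemma distr_quantile: "distr \<mu> borel (quantile0 F) = interval_measure (\<lambda>x. v (F x))"
proof (rule cdf_unique)
  have mono: "v (F x) \<le> v (F y)" if "x \<le> y" for x y
    using that is_cdf_mono[OF F] by (auto simp: v_F mono_def intro: w_mono)
  have right: "continuous (at_right x) (\<lambda>x. v (F x))" for x
    unfolding v_F
    by (rule continuous_at_right_compose_mono[OF is_cdf_mono[OF F] is_cdf_right_cont[OF F] w_right_cont])
  have bot: "((\<lambda>x. v (F x)) \<longlongrightarrow> 0) at_bot"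
  proof -
    \<comment> \<open>Since w vanishes to the left of 0, its right continuity there becomes full
      continuity and can be composed with the limit of F.\<close>
    have "\<forall>\<^sub>F x in at_left 0. w x = w 0"
      by (intro eventually_at_leftI[of "-1"]) (auto simp: w_0)
    then have "isCont w 0"
      using w_right_cont[of 0] tendsto_eventually[of w "w 0" "at_left 0"]
      unfolding continuous_at_split by (auto simp: continuous_within)
    then show ?thesis
      using isCont_tendsto_compose[OF _ is_cdf_at_bot[OF F], of w] by (simp add: v_F w_0)
  qed
  show rd: "real_distribution (distr \<mu> borel (quantile0 F))"
    by (rule \<mu>.real_distribution_distr) measurable
  have cdf: "cdf (distr \<mu> borel (quantile0 F)) x = v (F x)" for x
  proof -
    have "measure \<mu> (quantile0 F -` {..x}) = measure \<mu> {..F x}"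
    proof (rule \<mu>.finite_measure_eq_AE)
      show "AE \<alpha> in \<mu>. \<alpha> \<in> quantile0 F -` {..x} \<longleftrightarrow> \<alpha> \<in> {..F x}"
        using AE_\<mu> by eventually_elim (simp add: quantile0_le_iff)
      show "quantile0 F -` {..x} \<in> sets \<mu>"
        using measurable_sets_borel[OF measurable_quantile0_F, of "{..x}"] by simp
    qed auto
    then show ?thesis
      by (simp add: cdf_def measure_distr v_F flip: cdf_\<mu>)
  qed
  \<comment> \<open>This limit is read off the pushforward, a probability measure whose distribution
    function has just been computed.\<close>
  have "((\<lambda>x. v (F x)) \<longlongrightarrow> 1) at_top"
    using real_distribution.cdf_lim_at_top_prob[OF rd] unfolding cdf[abs_def, symmetric] by simp
  then show "real_distribution (interval_measure (\<lambda>x. v (F x)))"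
    using mono right bot by (intro real_distribution_interval_measure) auto
  show "cdf (distr \<mu> borel (quantile0 F)) = cdf (interval_measure (\<lambda>x. v (F x)))"
    using cdf mono right bot by (subst cdf_interval_measure) auto
qed

text \<open>Carries the moment hypothesis on d(v \<circ> F) over to \<mu> by change of
  variables.\<close>

lemma integrable_u_quantile:
  assumes "(\<integral>\<^sup>+ x. ennreal \<bar>u x\<bar> \<partial>interval_measure (\<lambda>x. v (F x))) < \<infinity>"
  shows "integrable \<mu> (\<lambda>\<alpha>. u (quantile0 F \<alpha>))"
proof (rule integrableI_bounded)
  show "(\<integral>\<^sup>+ \<alpha>. ennreal (norm (u (quantile0 F \<alpha>))) \<partial>\<mu>) < \<infinity>"
    using assms unfolding distr_quantile[symmetric] by (subst (asm) nn_integral_distr) auto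
qed measurable

lemma measurable_F [measurable]: "F \<in> borel_measurable borel"
  using is_cdf_mono[OF F] by (rule borel_measurable_mono)

text \<open>Tonelli for the region 0 < \<alpha> \<le> F x, x < c. Its slice at x has \<mu>-mass v (F
  x). Its slice at \<alpha> runs from the quantile up to c, so it has mass u c - u (F\<inverse>
  \<alpha>), or is empty when the quantile is at least c; monotonicity of u makes the positive part
  cover both cases.\<close>

lemma nn_integral_eq_hinge:
  assumes int: "integrable \<mu> (\<lambda>\<alpha>. u (quantile0 F \<alpha>))"
  shows "(\<integral>\<^sup>+ x\<in>{..<c}. ennreal (v (F x)) \<partial>left_interval_measure u)
     = ennreal (LINT \<alpha>|\<mu>. max 0 (u c - u (quantile0 F \<alpha>)))" (is "?L = _")
proof -
  let ?\<nu> = "left_interval_measure u"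
  have u: "mono u" "\<And>x. continuous (at_left x) u"
    using sp by (auto simp: standard_pair_def)
  interpret \<nu>: sigma_finite_measure ?\<nu>
    by (rule sigma_finite_left_interval_measure[OF u])
  interpret pair_sigma_finite \<mu> ?\<nu> ..
  let ?f = "\<lambda>\<alpha> x. indicator {z. 0 < fst z \<and> fst z \<le> F (snd z) \<and> snd z < c} (\<alpha>, x) :: ennreal"
  have "?L = (\<integral>\<^sup>+ x. (\<integral>\<^sup>+ \<alpha>. ?f \<alpha> x \<partial>\<mu>) \<partial>?\<nu>)"
  proof (rule nn_integral_cong)
    fix x
    have "(\<integral>\<^sup>+ \<alpha>. ?f \<alpha> x \<partial>\<mu>) = (\<integral>\<^sup>+ \<alpha>. indicator {..<c} x * indicator {0<..F x} \<alpha> \<partial>\<mu>)"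
      by (intro nn_integral_cong) (auto split: split_indicator)
    also have "\<dots> = indicator {..<c} x * ennreal (v (F x))"
      by (simp add: nn_integral_cmult emeasure_\<mu>_F)
    finally show "ennreal (v (F x)) * indicator {..<c} x = (\<integral>\<^sup>+ \<alpha>. ?f \<alpha> x \<partial>\<mu>)"
      by (simp add: mult.commute)
  qed
  also have "\<dots> = (\<integral>\<^sup>+ \<alpha>. (\<integral>\<^sup>+ x. ?f \<alpha> x \<partial>?\<nu>) \<partial>\<mu>)"
    by (rule Fubini') measurable
  also have "\<dots> = (\<integral>\<^sup>+ \<alpha>. ennreal (max 0 (u c - u (quantile0 F \<alpha>))) \<partial>\<mu>)"
  proof (rule nn_integral_cong_AE)
    show "AE \<alpha> in \<mu>. (\<integral>\<^sup>+ x. ?f \<alpha> x \<partial>?\<nu>) = ennreal (max 0 (u c - u (quantile0 F \<alpha>)))"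
      using AE_\<mu>
    proof eventually_elim
      case (elim \<alpha>)
      have "(\<integral>\<^sup>+ x. ?f \<alpha> x \<partial>?\<nu>) = (\<integral>\<^sup>+ x. indicator {quantile0 F \<alpha>..<c} x \<partial>?\<nu>)"
        using elim by (intro nn_integral_cong) (auto simp: quantile0_le_iff split: split_indicator)
      also have "\<dots> = emeasure ?\<nu> {quantile0 F \<alpha>..<c}" by simp
      also have "\<dots> = ennreal (max 0 (u c - u (quantile0 F \<alpha>)))"
      proof (cases "quantile0 F \<alpha> \<le> c")
        case True
        then show ?thesis
          using emeasure_left_interval_measure[OF u True] u_mono[OF True] by simp
      next
        case False
        then show ?thesis
          using u_mono[of c "quantile0 F \<alpha>"] by simp
      qed
      finally show ?case .
    qed
  qed
  also have "\<dots> = ennreal (LINT \<alpha>|\<mu>. max 0 (u c - u (quantile0 F \<alpha>)))"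
    using int by (intro nn_integral_eq_integral) auto
  finally show ?thesis .
qed

text \<open>At \<open>p = 1\<close> the segment \<open>{0<..1}\<close> is exhausted from below because \<open>\<mu>\<close> has no atom at \<open>1\<close>.\<close>

lemma segment_integral_limit:
  fixes h :: "real \<Rightarrow> real"
  assumes "integrable \<mu> h"
  shows "(\<lambda>n. LINT \<alpha>:{0<..1 - inverse (real (Suc n))}|\<mu>. h \<alpha>) \<longlonglongrightarrow> (LINT \<alpha>:{0<..1}|\<mu>. h \<alpha>)"
proof -
  let ?A = "\<lambda>n. {0<..1 - inverse (real (Suc n))}"
  have sub: "(\<Union>n. ?A n) = {0<..<1}"
  proof -
    have "(\<exists>n. x \<le> 1 - inverse (real (Suc n))) \<longleftrightarrow> x < 1" for x
    proof
      assume "\<exists>n. x \<le> 1 - inverse (real (Suc n))"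
      then obtain n where "x \<le> 1 - inverse (real (Suc n))" ..
      moreover have "0 < inverse (real (Suc n))" by simp
      ultimately show "x < 1" by linarith
    next
      assume "x < 1"
      then obtain n where "inverse (real (Suc n)) < 1 - x"
        using reals_Archimedean[of "1 - x"] by (meson diff_gt_0_iff_gt)
      then show "\<exists>n. x \<le> 1 - inverse (real (Suc n))"
        by (intro exI[of _ n]) linarith
    qed
    then show ?thesis
      unfolding set_eq_iff UN_iff greaterThanAtMost_iff greaterThanLessThan_iff by blast
  qed
  have "(\<lambda>n. LINT \<alpha>:?A n|\<mu>. h \<alpha>) \<longlonglongrightarrow> (LINT \<alpha>:(\<Union>n. ?A n)|\<mu>. h \<alpha>)"
  proof (rule set_integral_cont_up)
    show "incseq ?A"
    proof (rule incseq_SucI)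
      fix n
      have "inverse (real (Suc (Suc n))) \<le> inverse (real (Suc n))"
        by (rule le_imp_inverse_le) auto
      then show "?A n \<subseteq> ?A (Suc n)"
        by (intro subsetI, unfold greaterThanAtMost_iff) linarith
    qed
    show "set_integrable \<mu> (\<Union>n. ?A n) h"
      unfolding sub set_integrable_def using assms by (intro integrable_mult_indicator) auto
  qed auto
  also have "(LINT \<alpha>:(\<Union>n. ?A n)|\<mu>. h \<alpha>) = (LINT \<alpha>:{0<..1}|\<mu>. h \<alpha>)"
    unfolding sub set_lebesgue_integral_def
    using assms AE_\<mu> by (intro integral_cong_AE) (auto split: split_indicator)
  finally show ?thesis .
qed

end

section \<open>The hinge inequality\<close>

text \<open>Pointwise, an indicator times y is at most the positive part of y; finiteness of M makes
  the constant t integrable.\<close>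

lemma set_integral_le_hinge:
  fixes h :: "'a \<Rightarrow> real"
  assumes "finite_measure M" "integrable M h" "S \<in> sets M"
  shows "(LINT x:S|M. t - h x) \<le> (LINT x|M. max 0 (t - h x))"
proof -
  interpret finite_measure M by fact
  show ?thesis
    unfolding set_lebesgue_integral_def using assms
    by (intro integral_mono integrable_mult_indicator) (auto split: split_indicator)
qed

text \<open>Here S separates the points where t - h is nonnegative from those where it is
  nonpositive, so restricting to S takes exactly the positive part.\<close>

lemma set_integral_eq_hinge:
  fixes h :: "'a \<Rightarrow> real"
  assumes "integrable M h" "S \<in> sets M"
    and "AE x in M. (x \<in> S \<longrightarrow> h x \<le> t) \<and> (x \<notin> S \<longrightarrow> t \<le> h x)"
  shows "(LINT x:S|M. t - h x) = (LINT x|M. max 0 (t - h x))"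
  unfolding set_lebesgue_integral_def
proof (rule integral_cong_AE)
  show "AE x in M. indicator S x *\<^sub>R (t - h x) = max 0 (t - h x)"
    using assms(3) by eventually_elim (auto split: split_indicator)
qed (use assms in measurable)

text \<open>Both sides contain the same finite integral of t over S, which cancels; the minus sign
  reverses the inequality.\<close>

lemma set_integral_const_diff_le_iff:
  fixes g h :: "'a \<Rightarrow> real"
  assumes "finite_measure M" "integrable M g" "integrable M h" "S \<in> sets M"
  shows "(LINT x:S|M. t - g x) \<le> (LINT x:S|M. t - h x) \<longleftrightarrow> (LINT x:S|M. h x) \<le> (LINT x:S|M. g x)"
proof -
  interpret finite_measure M by fact
  have *: "(LINT x:S|M. t - k x) = (LINT x:S|M. t) - (LINT x:S|M. k x)" if "integrable M k" for k
    using that assms(4)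
    by (intro set_integral_diff) (auto simp: set_integrable_def intro!: integrable_mult_indicator
        simp del: real_scaleR_def)
  show ?thesis using *[OF assms(2)] *[OF assms(3)] by simp
qed

section \<open>Comparison of two distribution functions\<close>

theorem lemma1:
  fixes u0 v0 F1 F2 :: "real \<Rightarrow> real"
  assumes "standard_pair u0 v0"
    and "is_cdf F1" and "is_cdf F2"
    and "(\<integral>\<^sup>+ x. ennreal \<bar>u0 x\<bar> \<partial>interval_measure (\<lambda>x. v0 (F1 x))) < \<infinity>"
    and "(\<integral>\<^sup>+ x. ennreal \<bar>u0 x\<bar> \<partial>interval_measure (\<lambda>x. v0 (F2 x))) < \<infinity>"
  shows "(\<forall>c::real.
            (\<integral>\<^sup>+ x\<in>{..<c}. ennreal (v0 (F1 x)) \<partial>left_interval_measure u0)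
              \<ge> (\<integral>\<^sup>+ x\<in>{..<c}. ennreal (v0 (F2 x)) \<partial>left_interval_measure u0))
     \<longleftrightarrow> (\<forall>p\<in>{0..<1}.
            (LINT \<alpha>:{0<..p}|unit_interval_measure v0. u0 (quantile F1 \<alpha>))
              \<le> (LINT \<alpha>:{0<..p}|unit_interval_measure v0. u0 (quantile F2 \<alpha>)))"
proof -
  interpret A: standard_pair_cdf u0 v0 F1 by standard (fact assms)+
  interpret B: standard_pair_cdf u0 v0 F2 by standard (fact assms)+
  let ?\<mu> = "unit_interval_measure v0"
  let ?g = "\<lambda>\<alpha>. u0 (quantile0 F1 \<alpha>)" and ?h = "\<lambda>\<alpha>. u0 (quantile0 F2 \<alpha>)"
  have g: "integrable ?\<mu> ?g" and h: "integrable ?\<mu> ?h"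
    using A.integrable_u_quantile B.integrable_u_quantile assms(4,5) by auto
  have fin: "finite_measure ?\<mu>" by (rule A.\<mu>.finite_measure_axioms)
  note hinge_le = set_integral_le_hinge[OF fin]
    and le_iff = set_integral_const_diff_le_iff[OF fin h g]
  \<comment> \<open>For p < 1 the segment stays inside the open unit interval, where
    \<open>quantile0\<close> and \<open>quantile\<close> agree.\<close>
  have seg: "(LINT \<alpha>:{0<..p}|?\<mu>. u0 (quantile F \<alpha>)) = (LINT \<alpha>:{0<..p}|?\<mu>. u0 (quantile0 F \<alpha>))"
    if "p < 1" for p F
    using that by (intro set_lebesgue_integral_cong) (auto simp: quantile0_def)
  \<comment> \<open>Lets \<open>ennreal_le_iff\<close> turn the comparison of extended integrals
    into one of real numbers.\<close>
  have nonneg: "0 \<le> (LINT \<alpha>|?\<mu>. max 0 (u0 c - ?g \<alpha>))" for c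
    by (rule integral_nonneg_AE) auto
  have "(\<forall>c. (LINT \<alpha>|?\<mu>. max 0 (u0 c - ?h \<alpha>)) \<le> (LINT \<alpha>|?\<mu>. max 0 (u0 c - ?g \<alpha>)))
     \<longleftrightarrow> (\<forall>p\<in>{0..<1}. (LINT \<alpha>:{0<..p}|?\<mu>. ?g \<alpha>) \<le> (LINT \<alpha>:{0<..p}|?\<mu>. ?h \<alpha>))" (is "?i \<longleftrightarrow> ?ii")
  proof
    assume i: ?i
    show ?ii
    proof
      fix p :: real
      assume p: "p \<in> {0..<1}"
      show "(LINT \<alpha>:{0<..p}|?\<mu>. ?g \<alpha>) \<le> (LINT \<alpha>:{0<..p}|?\<mu>. ?h \<alpha>)"
      proof (cases "p = 0")
        \<comment> \<open>The segment is empty. This case is separate because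
          \<open>quantile0 F1 0\<close> is only a default value, not a usable threshold.\<close>
        case True
        then show ?thesis by (simp add: set_lebesgue_integral_def)
      next
        case False
        define c where "c = quantile0 F1 p"
        have "AE \<alpha> in ?\<mu>. (\<alpha> \<in> {0<..p} \<longrightarrow> ?g \<alpha> \<le> u0 c) \<and> (\<alpha> \<notin> {0<..p} \<longrightarrow> u0 c \<le> ?g \<alpha>)"
          using A.AE_\<mu> by eventually_elim
            (use p False in \<open>auto simp: c_def intro!: A.u_mono A.quantile0_mono\<close>)
        then have "(LINT \<alpha>:{0<..p}|?\<mu>. u0 c - ?g \<alpha>) = (LINT \<alpha>|?\<mu>. max 0 (u0 c - ?g \<alpha>))"
          by (intro set_integral_eq_hinge g) auto
        moreover have "(LINT \<alpha>:{0<..p}|?\<mu>. u0 c - ?h \<alpha>) \<le> (LINT \<alpha>|?\<mu>. max 0 (u0 c - ?h \<alpha>))"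
          by (rule hinge_le[OF h]) auto
        ultimately have "(LINT \<alpha>:{0<..p}|?\<mu>. u0 c - ?h \<alpha>) \<le> (LINT \<alpha>:{0<..p}|?\<mu>. u0 c - ?g \<alpha>)"
          using i[rule_format, of c] by linarith
        then show ?thesis by (subst (asm) le_iff) auto
      qed
    qed
  next
    assume ii: ?ii
    \<comment> \<open>The threshold F2 c used below may equal 1, which (ii) does not cover, so the
      endpoint is reached by a limit.\<close>
    have ii': "(LINT \<alpha>:{0<..p}|?\<mu>. ?g \<alpha>) \<le> (LINT \<alpha>:{0<..p}|?\<mu>. ?h \<alpha>)" if p: "0 \<le> p" "p \<le> 1" for p
    proof (cases "p = 1")
      case False
      then show ?thesis using ii p by auto
    next
      case True
      have "(LINT \<alpha>:{0<..1 - inverse (real (Suc n))}|?\<mu>. ?g \<alpha>)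
          \<le> (LINT \<alpha>:{0<..1 - inverse (real (Suc n))}|?\<mu>. ?h \<alpha>)" for n
        using ii by (auto simp: field_simps)
      then show ?thesis
        unfolding True
        by (intro LIMSEQ_le[OF A.segment_integral_limit[OF g] A.segment_integral_limit[OF h]]) auto
    qed
    show ?i
    proof
      fix c
      let ?S = "{0<..F2 c}"
      \<comment> \<open>On (0,1), membership of \<alpha> in the segment is equivalent to its
        F2-quantile being at most c, so the segment separates the signs of the hinge.\<close>
      have "AE \<alpha> in ?\<mu>. (\<alpha> \<in> ?S \<longrightarrow> ?h \<alpha> \<le> u0 c) \<and> (\<alpha> \<notin> ?S \<longrightarrow> u0 c \<le> ?h \<alpha>)"
        using B.AE_\<mu>
      proof eventually_elim
        case (elim \<alpha>)
        then show ?case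
          using B.quantile0_le_iff[of \<alpha> c] by (auto intro!: B.u_mono)
      qed
      then have "(LINT \<alpha>|?\<mu>. max 0 (u0 c - ?h \<alpha>)) = (LINT \<alpha>:?S|?\<mu>. u0 c - ?h \<alpha>)"
        by (intro set_integral_eq_hinge[symmetric] h) auto
      also have "\<dots> \<le> (LINT \<alpha>:?S|?\<mu>. u0 c - ?g \<alpha>)"
        using ii'[of "F2 c"] is_cdf_nonneg[OF assms(3)] is_cdf_le_1[OF assms(3)]
        by (subst le_iff) auto
      also have "\<dots> \<le> (LINT \<alpha>|?\<mu>. max 0 (u0 c - ?g \<alpha>))"
        by (rule hinge_le[OF g]) auto
      finally show "(LINT \<alpha>|?\<mu>. max 0 (u0 c - ?h \<alpha>)) \<le> (LINT \<alpha>|?\<mu>. max 0 (u0 c - ?g \<alpha>))" .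
    qed
  qed
  then show ?thesis
    by (simp add: A.nn_integral_eq_hinge[OF g] B.nn_integral_eq_hinge[OF h] seg ennreal_le_iff[OF nonneg])
qed

end
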